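(* Let $n,m\ge 1$, let $g_1,\ldots,g_m$ be computable functions from $\mathbb{Z}^{n+1}$ to $\mathbb{Z}^n$, and let $PROG=(S,I,R)$ be the while-loop program with vector of variables $\vec x=(x[1],\ldots,x[n])$ determined by $g_1,\ldots,g_m$. Assume there exist functions $f_1(\vec x),\ldots,f_M(\vec x)$ from $\mathbb{Z}^n$ to $\mathbb{N}$ such that the following holds: for each computational segment $t_1,\ldots,t_L$ with $L\ge 2$ there exists $k$ with $1\le k\le M$ such that the value of $f_k(\vec x)$ in $t_L$ is strictly less than the value of $f_k(\vec x)$ in $t_1$. Then any computation of $PROG$ is finite.
   Context: $\mathbb{N}=\{0,1,2,\ldots\}$. The while-loop program determined by $g_1,\ldots,g_m:\mathbb{Z}^{n+1}\to\mathbb{Z}^n$ is the following. The state is $X=(x[1],\ldots,x[n])\in\mathbb{Z}^n$; initially $X$ is an arbitrary element of $\mathbb{Z}^n$ supplied by the user. While $x[1]>0$ and $x[2]>0$ and $\cdots$ and $x[n]>0$, the user chooses $\mathrm{control}=i\in\{1,\ldots,m\}$ and an integer $u\in\mathbb{Z}$, and $X$ is replaced by $g_i(X,u)$. Formally $S=I=\mathbb{Z}^n$, and $R(s,t)$ holds iff all coordinates of $s$ are positive and there exist $i\in\{1,\ldots,m\}$ and $u\in\mathbb{Z}$ with $t=g_i(s,u)$. A computation is a finite or infinite sequence of states $s_1,s_2,\ldots$ with $s_1\in I$, with $R(s_i,s_{i+1})$ for all consecutive terms, and such that if the sequence is finite with last state $s$ then there is no $t$ with $R(s,t)$. A computational segment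 is a finite sequence of states $t_1,\ldots,t_L$ such that $R(t_i,t_{i+1})$ for all $1\le i\le L-1$ (it is not required that $t_1\in I$ or that $t_L$ be terminal). *)

theory Defs
  imports Main "HOL-Library.FuncSet" "HOL-Library.Nat_Bijection"
begin

section \<open>Programs and computations\<close>

record 'a program =
  states :: "'a set"
  init :: "'a set"
  trans :: "'a \<Rightarrow> 'a \<Rightarrow> bool"

datatype 'a sequence = Fin "'a list" | Inf "nat \<Rightarrow> 'a"

text \<open>The term \<open>s\<^sub>i\<close> of the informal numbering (from 1) is \<open>ss ! (i - 1)\<close> in \<open>Fin ss\<close>
  and \<open>s (i - 1)\<close> in \<open>Inf s\<close>.\<close>

primrec finite_sequence :: "'a sequence \<Rightarrow> bool" where
  "finite_sequence (Fin ss) = True"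
| "finite_sequence (Inf s) = False"

primrec computation :: "'a program \<Rightarrow> 'a sequence \<Rightarrow> bool" where
  "computation P (Fin ss) \<longleftrightarrow>
     ss \<noteq> [] \<and> set ss \<subseteq> states P \<and> hd ss \<in> init P \<and> successively (trans P) ss \<and>
     \<not> (\<exists>t \<in> states P. trans P (last ss) t)"
| "computation P (Inf s) \<longleftrightarrow>
     range s \<subseteq> states P \<and> s 0 \<in> init P \<and> (\<forall>i. trans P (s i) (s (Suc i)))"

definition computational_segment :: "'a program \<Rightarrow> 'a list \<Rightarrow> bool" where
  "computational_segment P ts \<longleftrightarrow>
     ts \<noteq> [] \<and> set ts \<subseteq> states P \<and> successively (trans P) ts"


section \<open>While-loop programs over integer vectors\<close>

definition int_vec :: "nat \<Rightarrow> int list set" where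
  "int_vec k = {v. length v = k}"

text \<open>An element \<open>(X, u)\<close> of \<open>\<int>\<^sup>n\<^sup>+\<^sup>1\<close> is the list \<open>X @ [u]\<close>.\<close>

definition while_program ::
  "nat \<Rightarrow> nat \<Rightarrow> (nat \<Rightarrow> int list \<Rightarrow> int list) \<Rightarrow> int list program" where
  "while_program n m g =
     \<lparr>states = int_vec n,
      init = int_vec n,
      trans = (\<lambda>s t. s \<in> int_vec n \<and> (\<forall>j<n. s ! j > 0) \<and>
                     (\<exists>i \<in> {1..m}. \<exists>u. t = g i (s @ [u])))\<rparr>"


section \<open>Computable functions\<close>

text \<open>
  Partial recursive functions. An expression carries no arity: the length of the argument list
  determines the arity at the root, and thereby at every subexpression. \<open>rec_eval r xs y\<close> says
  that the partial function denoted by \<open>r\<close> is defined at \<open>xs\<close> with value \<open>y\<close>; it never holds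
  when an arity does not fit.
\<close>

datatype recf =
    Zero
  | Succ
  | Proj nat
  | Comp recf "recf list"
  | PrimRec recf recf
  | Minim recf

inductive rec_eval :: "recf \<Rightarrow> nat list \<Rightarrow> nat \<Rightarrow> bool" where
  zero: "rec_eval Zero xs 0"
| succ: "rec_eval Succ [x] (Suc x)"
| proj: "i < length xs \<Longrightarrow> rec_eval (Proj i) xs (xs ! i)"
| comp: "list_all2 (\<lambda>h y. rec_eval h xs y) hs ys \<Longrightarrow> rec_eval f ys z
           \<Longrightarrow> rec_eval (Comp f hs) xs z"
| primrec_0: "rec_eval f xs z \<Longrightarrow> rec_eval (PrimRec f h) (0 # xs) z"
| primrec_Suc: "rec_eval (PrimRec f h) (k # xs) r \<Longrightarrow> rec_eval h (k # r # xs) z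
           \<Longrightarrow> rec_eval (PrimRec f h) (Suc k # xs) z"
| minim: "rec_eval f (k # xs) 0 \<Longrightarrow> (\<forall>j<k. \<exists>y>0. rec_eval f (j # xs) y)
           \<Longrightarrow> rec_eval (Minim f) xs k"

lemma rec_eval_deterministic:
  "rec_eval r xs y \<Longrightarrow> rec_eval r xs z \<Longrightarrow> y = z"
proof (induction arbitrary: z rule: rec_eval.induct)
  case (zero xs)
  then show ?case by (auto elim: rec_eval.cases)
next
  case (succ x)
  then show ?case by (auto elim: rec_eval.cases)
next
  case (proj i xs)
  from proj(2) show ?case by cases auto
next
  case (comp xs hs ys f y)
  from comp.prems obtain ys' where ys': "list_all2 (\<lambda>h y. rec_eval h xs y) hs ys'"
    and f: "rec_eval f ys' z" by cases auto
  have "ys = ys'"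
    using comp.IH(1) ys' by (auto simp: list_all2_conv_all_nth intro!: nth_equalityI)
  with f comp.IH(2) show ?case by blast
next
  case (primrec_0 f xs y h)
  from primrec_0.prems have "rec_eval f xs z" by cases auto
  with primrec_0.IH show ?case by blast
next
  case (primrec_Suc f h k xs r y)
  from primrec_Suc.prems obtain r' where
    "rec_eval (PrimRec f h) (k # xs) r'" "rec_eval h (k # r' # xs) z" by cases auto
  with primrec_Suc.IH show ?case by blast
next
  case (minim f k xs)
  from minim.prems have z: "rec_eval f (z # xs) 0" "\<forall>j<z. \<exists>y>0. rec_eval f (j # xs) y"
    by (cases, auto)+
  have "\<not> k < z" using z(2) minim.IH(1) by (metis less_irrefl)
  moreover have "\<not> z < k" using z(1) minim.IH(2) by (metis less_irrefl)
  ultimately show ?case by simp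
qed

text \<open>
  A function from \<open>\<int>\<^sup>p\<close> to \<open>\<int>\<^sup>q\<close> is computable if each of its coordinate functions is total
  recursive, the integers being coded by the bijection \<open>int_encode\<close> onto the naturals.
\<close>

definition computable_int_fun :: "nat \<Rightarrow> nat \<Rightarrow> (int list \<Rightarrow> int list) \<Rightarrow> bool" where
  "computable_int_fun p q F \<longleftrightarrow>
     F \<in> int_vec p \<rightarrow> int_vec q \<and>
     (\<forall>j<q. \<exists>r. \<forall>v \<in> int_vec p. rec_eval r (map int_encode v) (int_encode (F v ! j)))"

end

theory Submission
  imports Defs "HOL-Library.Ramsey"
begin

text \<open>
  Along an infinite computation every pair of positions \<open>i < j\<close> bounds a segment, so some \<open>f\<^sub>k\<close>
  decreases from \<open>i\<close> to \<open>j\<close>. Hence the transitive relation \<open>j > i\<close> on positions is covered by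
  finitely many well-founded relations, and by Ramsey's theorem it would be well-founded itself.
\<close>

lemma no_pairwise_descending_measures:
  fixes f :: "nat \<Rightarrow> 'a \<Rightarrow> nat" and s :: "nat \<Rightarrow> 'a"
  shows "\<not> (\<forall>i j. i < j \<longrightarrow> (\<exists>k \<in> {1..M}. f k (s j) < f k (s i)))"
proof
  assume dec: "\<forall>i j. i < j \<longrightarrow> (\<exists>k \<in> {1..M}. f k (s j) < f k (s i))"
  \<comment> \<open>Later positions count as smaller, so \<open>0, 1, 2, ...\<close> is a descending
    chain of \<open>r\<close>.\<close>
  define r :: "(nat \<times> nat) set" where "r = {(j, i). i < j}"
  have "disj_wf r"
    unfolding disj_wf
  proof (intro exI conjI allI impI)
    show "wf (measure (\<lambda>i. f k (s i)))" for k by simp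
    \<comment> \<open>\<open>disj_wf\<close> indexes from 0, so the bound \<open>Suc M\<close> is
      needed to reach \<open>k = M\<close>; the index 0 only enlarges the union.\<close>
    show "r \<subseteq> (\<Union>k<Suc M. measure (\<lambda>i. f k (s i)))"
      using dec by (fastforce simp: r_def less_Suc_eq_le)
  qed
  moreover have "Relation.trans r"
    by (rule transI) (auto simp: r_def)
  \<comment> \<open>Ramsey's theorem enters through this rule.\<close>
  ultimately have "wf r"
    by (rule trans_disj_wf_implies_wf[rotated])
  moreover have "\<forall>i. (Suc i, i) \<in> r" by (simp add: r_def)
  ultimately show False
    unfolding wf_iff_no_infinite_down_chain by (metis id_apply)
qed

text \<open>Both endpoints are kept, so that the list has length at least 2 and the hypothesis on
  segments compares exactly \<open>s i\<close> with \<open>s j\<close>.\<close>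

lemma computational_segment_of_Inf:
  assumes "computation P (Inf s)" and "i < j"
  shows "computational_segment P (map s [i..<Suc j])"
  using assms
  by (auto simp: computational_segment_def successively_conv_nth simp del: upt_Suc)

theorem theorem7p2:
  fixes n m :: nat
    and g :: "nat \<Rightarrow> int list \<Rightarrow> int list"
  assumes "n \<ge> 1" and "m \<ge> 1"
    and "\<forall>i \<in> {1..m}. computable_int_fun (n + 1) n (g i)"
    and "\<exists>(M :: nat) (f :: nat \<Rightarrow> int list \<Rightarrow> nat).
           \<forall>ts. computational_segment (while_program n m g) ts \<and> length ts \<ge> 2 \<longrightarrow>
             (\<exists>k \<in> {1..M}. f k (last ts) < f k (hd ts))"
  shows "\<forall>c. computation (while_program n m g) c \<longrightarrow> finite_sequence c"
proof (intro allI impI)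
  fix c assume c: "computation (while_program n m g) c"
  obtain M :: nat and f :: "nat \<Rightarrow> int list \<Rightarrow> nat" where
    dec: "\<exists>k \<in> {1..M}. f k (last ts) < f k (hd ts)"
      if "computational_segment (while_program n m g) ts" "length ts \<ge> 2" for ts
    using assms(4) by blast
  show "finite_sequence c"
  proof (cases c)
    case (Inf s)
    have "\<exists>k \<in> {1..M}. f k (s j) < f k (s i)" if "i < j" for i j
      using dec[OF computational_segment_of_Inf[OF c[unfolded Inf] that]] that
      by (simp add: last_map hd_map del: upt_Suc)
    then show ?thesis
      using no_pairwise_descending_measures[of M f s] by blast
  qed simp
qed

end
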